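(* Let $k\ge 1$ and $n\ge 0$ be integers, let $A$ be an abelian group, and let $\nu$ be an $A$-valued type $n$ invariant of pure braids on $k$ strands, regarded as a $\mathbb{Z}$-linear map $\nu:\widetilde{PB_k}\to A$ on formal linear combinations of words in the generators (and their inverses) of a finite presentation of the pure braid group $PB_k$. Let $\omega:=\nu\circ s^{-1}:\widetilde{PB_k}\to A$, where $s$ is the subword map. Then $\nu=\omega\circ s$ and $\omega(w)=0$ for every word $w$ of length greater than $n$.
   Context: Fix a finite presentation of the pure braid group $PB_k$ on $k$ strands, and let $S\subseteq PB_k$ be the set consisting of its generators and their inverses. $\widetilde{PB_k}$ is the free $\mathbb{Z}$-module on the set of all finite words in the alphabet $S$, including non-reduced words and the empty word, denoted $1$. An invariant $\nu$ of pure braids is a function $PB_k\to A$; it is regarded as a $\mathbb{Z}$-linear map on $\widetilde{PB_k}$ by sending a word to the value of $\nu$ on the pure braid it represents. A subword of $g_1g_2\cdots g_m$ is a word obtained by keeping the letters in some subset of the positions, in order, and deleting the others. The $\mathbb{Z}$-linear map $s:\widetilde{PB_k}\to\widetilde{PB_k}$ sends a word to the sum of all its subwords (one summand for each subset of positions). It is invertible, with inverse $s^{-1}(g_1g_2\cdots g_m)=(g_1-1)(g_2-1)\cdots(g_m-1)$, expanded by concatenation of words, i.e. $s^{-1}(w)=\sum_{w'}(-1)^{m-|w'|}w'$ over subwords $w'$ (indexed by subsets of positions) of a word $w$ of length $m$, where $|w'|$ is the length of $w'$. An $A$-valued invariant $\nu$ of pure braids is extended to singular pure braids (with finitely many transverse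 double points) by $\nu(\text{double point})=\nu(\text{positive crossing})-\nu(\text{negative crossing})$ at each double point; $\nu$ is of type $n$ if this extension vanishes on all singular pure braids with more than $n$ double points. *)

theory Defs
  imports "HOL-Algebra.Free_Abelian_Groups" "HOL-Combinatorics.Transposition"
begin

section \<open>Group presentations\<close>

text \<open>A signed word over \<open>X\<close>: the letter \<open>(x, True)\<close> stands for \<open>x\<close>, the letter
  \<open>(x, False)\<close> for its inverse. Relations are pairs of signed words.\<close>

type_synonym 'x signed_word = "('x \<times> bool) list"

definition signed_words :: "'x set \<Rightarrow> 'x signed_word set" where
  "signed_words X = lists (X \<times> UNIV)"

inductive pres_eq :: "'x set \<Rightarrow> ('x signed_word \<times> 'x signed_word) set
    \<Rightarrow> 'x signed_word \<Rightarrow> 'x signed_word \<Rightarrow> bool"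
  for X R where
  pres_refl: "pres_eq X R u u"
| pres_sym: "pres_eq X R u v \<Longrightarrow> pres_eq X R v u"
| pres_trans: "pres_eq X R u v \<Longrightarrow> pres_eq X R v w \<Longrightarrow> pres_eq X R u w"
| pres_congr: "pres_eq X R u v \<Longrightarrow> pres_eq X R (p @ u @ q) (p @ v @ q)"
| pres_cancel: "x \<in> X \<Longrightarrow> pres_eq X R [(x, b), (x, \<not> b)] []"
| pres_relation: "(u, v) \<in> R \<Longrightarrow> pres_eq X R u v"

definition pres_class :: "'x set \<Rightarrow> ('x signed_word \<times> 'x signed_word) set
    \<Rightarrow> 'x signed_word \<Rightarrow> 'x signed_word set" where
  "pres_class X R u = {v \<in> signed_words X. pres_eq X R u v}"

definition presented_group :: "'x set \<Rightarrow> ('x signed_word \<times> 'x signed_word) set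
    \<Rightarrow> 'x signed_word set monoid" where
  "presented_group X R =
    \<lparr>carrier = pres_class X R ` signed_words X,
     monoid.mult = (\<lambda>P Q. \<Union>u\<in>P. \<Union>v\<in>Q. pres_class X R (u @ v)),
     one = pres_class X R []\<rparr>"

lemma pres_eq_append:
  assumes "pres_eq X R u u'" "pres_eq X R v v'"
  shows "pres_eq X R (u @ v) (u' @ v')"
  using pres_congr[OF assms(1), of "[]" v] pres_congr[OF assms(2), of u' "[]"]
  by (simp add: pres_trans[of X R "u @ v" "u' @ v" "u' @ v'"])

lemma pres_class_eqI:
  assumes "pres_eq X R u v"
  shows "pres_class X R u = pres_class X R v"
proof -
  have "pres_eq X R u w \<longleftrightarrow> pres_eq X R v w" for w
    by (meson assms pres_sym pres_trans)
  then show ?thesis by (simp add: pres_class_def)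
qed

lemma pres_class_eq_iff:
  assumes "v \<in> signed_words X"
  shows "pres_class X R u = pres_class X R v \<longleftrightarrow> pres_eq X R u v"
proof
  assume "pres_class X R u = pres_class X R v"
  moreover have "v \<in> pres_class X R v"
    using assms by (simp add: pres_class_def pres_refl)
  ultimately have "v \<in> pres_class X R u" by simp
  then show "pres_eq X R u v"
    by (simp add: pres_class_def)
qed (rule pres_class_eqI)

lemma mult_pres_class:
  assumes "u \<in> signed_words X" "v \<in> signed_words X"
  shows "pres_class X R u \<otimes>\<^bsub>presented_group X R\<^esub> pres_class X R v = pres_class X R (u @ v)"
proof -
  have "pres_class X R (u' @ v') = pres_class X R (u @ v)"
    if "u' \<in> pres_class X R u" "v' \<in> pres_class X R v" for u' v'
  proof -
    from that have "pres_eq X R u u'" "pres_eq X R v v'"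
      by (simp_all add: pres_class_def)
    then have "pres_eq X R (u @ v) (u' @ v')" by (rule pres_eq_append)
    then show ?thesis by (rule pres_class_eqI[symmetric])
  qed
  moreover have "u \<in> pres_class X R u" "v \<in> pres_class X R v"
    using assms by (simp_all add: pres_class_def pres_refl)
  ultimately have "(\<Union>u'\<in>pres_class X R u. \<Union>v'\<in>pres_class X R v. pres_class X R (u' @ v'))
      = pres_class X R (u @ v)"
    by blast
  then show ?thesis by (simp add: presented_group_def)
qed

lemma signed_words_append [simp]:
  "u @ v \<in> signed_words X \<longleftrightarrow> u \<in> signed_words X \<and> v \<in> signed_words X"
  by (auto simp: signed_words_def)

lemma Nil_signed_words [simp]: "[] \<in> signed_words X"
  by (simp add: signed_words_def)

definition inverse_word :: "'x signed_word \<Rightarrow> 'x signed_word" where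
  "inverse_word u = rev (map (\<lambda>(x, b). (x, \<not> b)) u)"

lemma inverse_word_signed_words [simp]:
  "u \<in> signed_words X \<Longrightarrow> inverse_word u \<in> signed_words X"
  by (auto simp: signed_words_def inverse_word_def)

lemma pres_eq_inverse_word:
  "u \<in> signed_words X \<Longrightarrow> pres_eq X R (inverse_word u @ u) []"
proof (induction u)
  case Nil
  show ?case by (simp add: inverse_word_def pres_refl)
next
  case (Cons a u)
  obtain x b where a: "a = (x, b)" by fastforce
  with Cons.prems have "x \<in> X" "u \<in> signed_words X" by (auto simp: signed_words_def)
  from pres_congr[OF pres_cancel[OF this(1), of R "\<not> b"], of "inverse_word u" u]
  have "pres_eq X R (inverse_word (a # u) @ a # u) (inverse_word u @ u)"
    by (simp add: inverse_word_def a)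
  with Cons.IH[OF \<open>u \<in> signed_words X\<close>] show ?case by (rule pres_trans[rotated])
qed

lemma group_presented_group: "group (presented_group X R)"
proof (rule groupI)
  let ?G = "presented_group X R"
  have carr: "carrier ?G = pres_class X R ` signed_words X"
    and one: "\<one>\<^bsub>?G\<^esub> = pres_class X R []" by (simp_all add: presented_group_def)
  show "\<one>\<^bsub>?G\<^esub> \<in> carrier ?G" by (simp add: carr one)
  show "x \<otimes>\<^bsub>?G\<^esub> y \<in> carrier ?G" if "x \<in> carrier ?G" "y \<in> carrier ?G" for x y
    using that by (auto simp: carr mult_pres_class)
  show "x \<otimes>\<^bsub>?G\<^esub> y \<otimes>\<^bsub>?G\<^esub> z = x \<otimes>\<^bsub>?G\<^esub> (y \<otimes>\<^bsub>?G\<^esub> z)"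
    if "x \<in> carrier ?G" "y \<in> carrier ?G" "z \<in> carrier ?G" for x y z
    using that by (auto simp: carr mult_pres_class)
  show "\<one>\<^bsub>?G\<^esub> \<otimes>\<^bsub>?G\<^esub> x = x" if "x \<in> carrier ?G" for x
    using that by (auto simp: carr one mult_pres_class)
  show "\<exists>y\<in>carrier ?G. y \<otimes>\<^bsub>?G\<^esub> x = \<one>\<^bsub>?G\<^esub>" if "x \<in> carrier ?G" for x
  proof -
    from that obtain u where u: "u \<in> signed_words X" "x = pres_class X R u" by (auto simp: carr)
    then have "pres_class X R (inverse_word u) \<otimes>\<^bsub>?G\<^esub> x = \<one>\<^bsub>?G\<^esub>"
      by (simp add: mult_pres_class one pres_class_eq_iff pres_eq_inverse_word)
    with u show ?thesis by (auto simp: carr)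
  qed
qed

definition eval_signed :: "('g, 'm) monoid_scheme \<Rightarrow> 'g signed_word \<Rightarrow> 'g" where
  "eval_signed G u =
    foldr (\<lambda>(x, b) y. (if b then x else inv\<^bsub>G\<^esub> x) \<otimes>\<^bsub>G\<^esub> y) u \<one>\<^bsub>G\<^esub>"

text \<open>\<open>\<langle>X | R\<rangle>\<close> is a finite presentation of \<open>G\<close> with generators \<open>X \<subseteq> G\<close>: evaluation of
  signed words in \<open>G\<close> induces a bijection from \<open>presented_group X R\<close> to \<open>G\<close>.\<close>

definition finite_presentation :: "('g, 'm) monoid_scheme \<Rightarrow> 'g set
    \<Rightarrow> ('g signed_word \<times> 'g signed_word) set \<Rightarrow> bool" where
  "finite_presentation G X R \<longleftrightarrow>
     finite X \<and> X \<subseteq> carrier G \<and>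
     finite R \<and> R \<subseteq> signed_words X \<times> signed_words X \<and>
     eval_signed G ` signed_words X = carrier G \<and>
     (\<forall>u\<in>signed_words X. \<forall>v\<in>signed_words X.
        eval_signed G u = eval_signed G v \<longleftrightarrow> pres_eq X R u v)"


section \<open>Braids and pure braids\<close>

text \<open>Artin's presentation of the braid group on \<open>k\<close> strands. The generator \<open>i \<in> {1..<k}\<close>
  is the positive crossing of the strands in positions \<open>i\<close> and \<open>i + 1\<close>.\<close>

definition artin_relations :: "nat \<Rightarrow> (nat signed_word \<times> nat signed_word) set" where
  "artin_relations k =
     {([(i, True), (j, True)], [(j, True), (i, True)]) | i j. 1 \<le> i \<and> i + 2 \<le> j \<and> j < k} \<union>
     {([(i, True), (i + 1, True), (i, True)], [(i + 1, True), (i, True), (i + 1, True)])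
       | i. 1 \<le> i \<and> i + 1 < k}"

type_synonym braid = "nat signed_word set"

definition braid_of :: "nat \<Rightarrow> nat signed_word \<Rightarrow> braid" where
  "braid_of k = pres_class {1..<k} (artin_relations k)"

definition braid_group :: "nat \<Rightarrow> braid monoid" where
  "braid_group k = presented_group {1..<k} (artin_relations k)"

text \<open>The permutation of the strands of a diagram whose successive crossings or double points
  are in the positions \<open>i\<^sub>1, i\<^sub>2, \<dots>\<close>.\<close>

definition strand_perm :: "nat list \<Rightarrow> nat \<Rightarrow> nat" where
  "strand_perm is = foldr (\<lambda>i p. transpose i (Suc i) \<circ> p) is id"

definition pure_braid_group :: "nat \<Rightarrow> braid monoid" where
  "pure_braid_group k = (braid_group k)
     \<lparr>carrier := {b \<in> carrier (braid_group k). \<forall>u\<in>b. strand_perm (map fst u) = id}\<rparr>"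

lemma strand_perm_append: "strand_perm (is @ js) = strand_perm is \<circ> strand_perm js"
  by (induction "is") (auto simp: strand_perm_def)

lemma strand_perm_artin:
  "pres_eq {1..<k} (artin_relations k) u v \<Longrightarrow> strand_perm (map fst u) = strand_perm (map fst v)"
proof (induction rule: pres_eq.induct)
  case (pres_congr u v p q)
  then show ?case by (simp add: strand_perm_append)
next
  case (pres_cancel x b)
  show ?case by (auto simp: strand_perm_def)
next
  case (pres_relation u v)
  then show ?case
    by (auto simp: artin_relations_def strand_perm_def fun_eq_iff transpose_def)
qed auto

lemma subgroup_pure_braids:
  "subgroup (carrier (pure_braid_group k)) (braid_group k)"
proof -
  let ?X = "{1..<k}" and ?R = "artin_relations k"
  interpret group "braid_group k"
    unfolding braid_group_def by (rule group_presented_group)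
  have carr: "carrier (pure_braid_group k) =
      braid_of k ` {u \<in> signed_words ?X. strand_perm (map fst u) = id}"
    unfolding pure_braid_group_def braid_group_def braid_of_def presented_group_def
    by (auto simp: pres_class_def intro: pres_refl) (metis strand_perm_artin One_nat_def)
  have mult: "braid_of k u \<otimes>\<^bsub>braid_group k\<^esub> braid_of k v = braid_of k (u @ v)"
    if "u \<in> signed_words ?X" "v \<in> signed_words ?X" for u v
    using that by (simp add: braid_of_def braid_group_def mult_pres_class)
  have one: "\<one>\<^bsub>braid_group k\<^esub> = braid_of k []"
    by (simp add: braid_of_def braid_group_def presented_group_def)
  have sub: "carrier (pure_braid_group k) \<subseteq> carrier (braid_group k)"
    by (auto simp: pure_braid_group_def)
  show ?thesis
  proof (rule subgroupI)
    show "carrier (pure_braid_group k) \<noteq> {}"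
      using carr by (auto simp: strand_perm_def intro!: exI[of _ "[]"])
    fix a assume a: "a \<in> carrier (pure_braid_group k)"
    then obtain u where u: "u \<in> signed_words ?X" "strand_perm (map fst u) = id" "a = braid_of k u"
      unfolding carr by blast
    have eq: "pres_eq ?X ?R (inverse_word u @ u) []"
      using u(1) by (rule pres_eq_inverse_word)
    from strand_perm_artin[OF this] u(2)
    have "strand_perm (map fst (inverse_word u)) = id"
      by (simp add: strand_perm_append) (simp add: strand_perm_def)
    then have mem: "braid_of k (inverse_word u) \<in> carrier (pure_braid_group k)"
      using u(1) by (auto simp: carr)
    have "braid_of k (inverse_word u) \<otimes>\<^bsub>braid_group k\<^esub> a = \<one>\<^bsub>braid_group k\<^esub>"
      using u(1) eq by (simp add: u(3) mult one) (simp add: braid_of_def pres_class_eq_iff)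
    then have "inv\<^bsub>braid_group k\<^esub> a = braid_of k (inverse_word u)"
      using mem a sub by (intro inv_equality) auto
    with mem show "inv\<^bsub>braid_group k\<^esub> a \<in> carrier (pure_braid_group k)" by simp
    fix b assume "b \<in> carrier (pure_braid_group k)"
    then obtain v where "v \<in> signed_words ?X" "strand_perm (map fst v) = id" "b = braid_of k v"
      unfolding carr by blast
    with u show "a \<otimes>\<^bsub>braid_group k\<^esub> b \<in> carrier (pure_braid_group k)"
      by (auto simp: carr mult strand_perm_append intro!: imageI)
  qed (rule sub)
qed

lemma group_pure_braid_group: "group (pure_braid_group k)"
proof -
  have "group (braid_group k)"
    unfolding braid_group_def by (rule group_presented_group)
  from group.subgroup_imp_group[OF this subgroup_pure_braids[of k]]
  show ?thesis by (simp add: pure_braid_group_def)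
qed


section \<open>Singular pure braids and finite type invariants\<close>

text \<open>Singular braids are given by their diagrams, that is, by words in the Artin generators,
  their inverses, and the generators \<open>DoublePoint i\<close> of the singular braid monoid (a double
  point between the strands in positions \<open>i\<close> and \<open>i + 1\<close>).\<close>

datatype singular_letter =
    is_Crossing: Crossing (position: nat) bool
  | is_DoublePoint: DoublePoint (position: nat)

definition double_points :: "singular_letter list \<Rightarrow> nat" where
  "double_points d = length (filter is_DoublePoint d)"

definition singular_pure_braids :: "nat \<Rightarrow> singular_letter list set" where
  "singular_pure_braids k =
     {d. (\<forall>c\<in>set d. position c \<in> {1..<k}) \<and> strand_perm (map position d) = id}"

text \<open>\<open>resolve f d\<close> replaces each double point of \<open>d\<close> by the difference of the positive and the
  negative crossing, where \<open>f\<close> gives the values on diagrams without double points.\<close>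

fun resolve :: "(nat signed_word \<Rightarrow> 'a::ab_group_add) \<Rightarrow> singular_letter list \<Rightarrow> 'a" where
  "resolve f [] = f []"
| "resolve f (Crossing i b # d) = resolve (\<lambda>u. f ((i, b) # u)) d"
| "resolve f (DoublePoint i # d) =
     resolve (\<lambda>u. f ((i, True) # u)) d - resolve (\<lambda>u. f ((i, False) # u)) d"

definition singular_extension :: "nat \<Rightarrow> (braid \<Rightarrow> 'a::ab_group_add) \<Rightarrow> singular_letter list \<Rightarrow> 'a"
  where "singular_extension k \<nu> = resolve (\<lambda>u. \<nu> (braid_of k u))"

definition type_invariant :: "nat \<Rightarrow> nat \<Rightarrow> (braid \<Rightarrow> 'a::ab_group_add) \<Rightarrow> bool" where
  "type_invariant k n \<nu> \<longleftrightarrow>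
     (\<forall>d\<in>singular_pure_braids k. double_points d > n \<longrightarrow> singular_extension k \<nu> d = 0)"


section \<open>Formal combinations of words and the subword map\<close>

definition letters :: "('g, 'm) monoid_scheme \<Rightarrow> 'g set \<Rightarrow> 'g set" where
  "letters G X = X \<union> m_inv G ` X"

definition eval_word :: "('g, 'm) monoid_scheme \<Rightarrow> 'g list \<Rightarrow> 'g" where
  "eval_word G w = foldr (\<lambda>g y. g \<otimes>\<^bsub>G\<^esub> y) w \<one>\<^bsub>G\<^esub>"

text \<open>The free \<open>\<int>\<close>-module on all words over \<open>S\<close>, as a set of finitely supported functions.\<close>

definition word_module :: "'s set \<Rightarrow> ('s list \<Rightarrow>\<^sub>0 int) set" where
  "word_module S = carrier (free_Abelian_group (lists S))"

definition int_multiple :: "int \<Rightarrow> 'a::ab_group_add \<Rightarrow> 'a" where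
  "int_multiple m a = (\<Sum>_<nat m. a) - (\<Sum>_<nat (- m). a)"

definition linear_extension :: "('b \<Rightarrow> 'a::ab_group_add) \<Rightarrow> ('b \<Rightarrow>\<^sub>0 int) \<Rightarrow> 'a" where
  "linear_extension f x =
     (\<Sum>b\<in>Poly_Mapping.keys x. int_multiple (Poly_Mapping.lookup x b) (f b))"

definition invariant_on_words :: "('g, 'm) monoid_scheme \<Rightarrow> ('g \<Rightarrow> 'a::ab_group_add)
    \<Rightarrow> ('g list \<Rightarrow>\<^sub>0 int) \<Rightarrow> 'a" where
  "invariant_on_words G \<nu> = linear_extension (\<lambda>w. \<nu> (eval_word G w))"

text \<open>\<open>nths w I\<close> is the subword of \<open>w\<close> on the positions in \<open>I\<close>.\<close>

definition subword_map :: "('s list \<Rightarrow>\<^sub>0 int) \<Rightarrow> ('s list \<Rightarrow>\<^sub>0 int)" where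
  "subword_map = frag_extend (\<lambda>w. \<Sum>I\<in>Pow {..<length w}. frag_of (nths w I))"

text \<open>\<open>(g\<^sub>1 - 1) \<dots> (g\<^sub>m - 1)\<close>, expanded.\<close>

definition subword_map_inverse :: "('s list \<Rightarrow>\<^sub>0 int) \<Rightarrow> ('s list \<Rightarrow>\<^sub>0 int)" where
  "subword_map_inverse = frag_extend (\<lambda>w. \<Sum>I\<in>Pow {..<length w}.
     frag_cmul ((- 1) ^ (length w - length (nths w I))) (frag_of (nths w I)))"

lemma frag_induct [case_names zero one diff]:
  assumes "P 0" "\<And>x. P (frag_of x)" "\<And>a b. P a \<Longrightarrow> P b \<Longrightarrow> P (a - b)"
  shows "P c"
  by (rule frag_induction[OF subset_UNIV]) (use assms in auto)

lemma sum_Pow_Suc: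
  fixes f :: "nat set \<Rightarrow> 'b::comm_monoid_add"
  shows "(\<Sum>I\<in>Pow {..<Suc n}. f I) =
    (\<Sum>I\<in>Pow {..<n}. f (Suc ` I)) + (\<Sum>I\<in>Pow {..<n}. f (insert 0 (Suc ` I)))"
proof -
  have eq: "Pow {..<Suc n} = (`) Suc ` Pow {..<n} \<union> (\<lambda>I. insert 0 (Suc ` I)) ` Pow {..<n}"
    by (simp only: lessThan_Suc_eq_insert_0 Pow_insert image_Pow_surj[OF refl, symmetric] image_image)
  have 1: "inj_on ((`) Suc) (Pow {..<n})"
    by (auto simp: inj_on_def inj_image_eq_iff)
  have 2: "inj_on (\<lambda>I. insert 0 (Suc ` I)) (Pow {..<n})"
    unfolding inj_on_def
    by (metis image_iff inj_image_eq_iff inj_Suc insert_ident nat.distinct(1))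
  show ?thesis unfolding eq
    by (subst sum.union_disjoint) (auto simp: sum.reindex[OF 1] sum.reindex[OF 2])
qed

lemma nths_Cons_Suc:
  "nths (x # w) (Suc ` I) = nths w I" "nths (x # w) (insert 0 (Suc ` I)) = x # nths w I"
  by (auto simp: nths_Cons inj_image_mem_iff)

definition prefix_letter :: "'s \<Rightarrow> ('s list \<Rightarrow>\<^sub>0 int) \<Rightarrow> ('s list \<Rightarrow>\<^sub>0 int)" where
  "prefix_letter x = frag_extend (\<lambda>w. frag_of (x # w))"

lemma subword_map_prefix:
  "subword_map (prefix_letter x y) = subword_map y + prefix_letter x (subword_map y)"
proof (induction y rule: frag_induct)
  case (one w)
  then show ?case
    by (simp add: subword_map_def prefix_letter_def sum_Pow_Suc nths_Cons_Suc frag_extend_sum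
        comp_def del: lessThan_Suc)
qed (auto simp: subword_map_def prefix_letter_def frag_extend_diff)

lemma subword_map_inverse_prefix:
  "subword_map_inverse (prefix_letter x y) =
     prefix_letter x (subword_map_inverse y) - subword_map_inverse y"
proof (induction y rule: frag_induct)
  case (one w)
  have le: "length (nths w I) \<le> length w" for I
    by (induction w arbitrary: I) (auto simp: nths_Cons le_SucI)
  let ?t = "\<lambda>I. (- 1) ^ (length w - length (nths w I)) :: int"
  have sign: "(- 1) ^ (Suc (length w) - length (nths w I)) = - ?t I" for I
    using le[of I] by (simp add: Suc_diff_le)
  have "subword_map_inverse (prefix_letter x (frag_of w)) =
      (\<Sum>I\<in>Pow {..<length w}. frag_cmul (- ?t I) (frag_of (nths w I))) +
      (\<Sum>I\<in>Pow {..<length w}. frag_cmul (?t I) (frag_of (x # nths w I)))"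
    unfolding subword_map_inverse_def prefix_letter_def frag_extend_of length_Cons sum_Pow_Suc
    by (simp only: nths_Cons_Suc length_Cons sign diff_Suc_Suc)
  moreover have "prefix_letter x (subword_map_inverse (frag_of w)) =
      (\<Sum>I\<in>Pow {..<length w}. frag_cmul (?t I) (frag_of (x # nths w I)))"
    unfolding subword_map_inverse_def prefix_letter_def frag_extend_of
    by (subst frag_extend_sum) (simp_all add: comp_def frag_extend_cmul)
  moreover have "(\<Sum>I\<in>Pow {..<length w}. frag_cmul (- ?t I) (frag_of (nths w I))) =
      - subword_map_inverse (frag_of w)"
    unfolding subword_map_inverse_def frag_extend_of minus_frag_cmul[symmetric]
    by (rule sum_negf)
  ultimately show ?case by simp
qed (auto simp: subword_map_inverse_def prefix_letter_def frag_extend_diff)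

lemma frag_of_Cons: "frag_of (x # w) = prefix_letter x (frag_of w)"
  by (simp add: prefix_letter_def)

lemma subword_map_diff [simp]: "subword_map (x - y) = subword_map x - subword_map y"
  by (simp add: subword_map_def frag_extend_diff)

lemma subword_map_inverse_diff [simp]:
  "subword_map_inverse (x - y) = subword_map_inverse x - subword_map_inverse y"
  by (simp add: subword_map_inverse_def frag_extend_diff)

lemma subword_map_inverse_add [simp]:
  "subword_map_inverse (x + y) = subword_map_inverse x + subword_map_inverse y"
  by (simp add: subword_map_inverse_def frag_extend_add)

lemma subword_map_inverse_right: "subword_map (subword_map_inverse x) = x"
proof (induction x rule: frag_induct)
  case (one w)
  show ?case
  proof (induction w)
    case Nil
    show ?case by (simp add: subword_map_def subword_map_inverse_def)
  next
    case (Cons a w)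
    then show ?case
      by (simp add: frag_of_Cons subword_map_prefix subword_map_inverse_prefix)
  qed
qed (auto simp: subword_map_def subword_map_inverse_def frag_extend_diff)

lemma subword_map_inverse_left: "subword_map_inverse (subword_map x) = x"
proof (induction x rule: frag_induct)
  case (one w)
  show ?case
  proof (induction w)
    case Nil
    show ?case by (simp add: subword_map_def subword_map_inverse_def)
  next
    case (Cons a w)
    then show ?case
      by (simp add: frag_of_Cons subword_map_prefix subword_map_inverse_prefix)
  qed
qed (auto simp: subword_map_def subword_map_inverse_def frag_extend_diff)

lemma keys_extend_nths:
  assumes "x \<in> word_module S"
  shows "frag_extend (\<lambda>w. \<Sum>I\<in>Pow {..<length w}. frag_cmul (c w I) (frag_of (nths w I))) x
    \<in> word_module S"
proof -
  have "Poly_Mapping.keys (\<Sum>I\<in>Pow {..<length w}. frag_cmul (c w I) (frag_of (nths w I)))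
      \<subseteq> lists S" if "w \<in> lists S" for w
    using that by (intro order.trans[OF keys_sum] UN_least order.trans[OF keys_cmul])
      (auto dest!: in_set_nthsD)
  with assms show ?thesis
    unfolding word_module_def carrier_free_Abelian_group_iff
    by (intro order.trans[OF keys_frag_extend] UN_least) blast
qed

lemma bij_betw_subword_map: "bij_betw subword_map (word_module S) (word_module S)"
proof (rule bij_betw_byWitness[where f' = subword_map_inverse])
  show "subword_map ` word_module S \<subseteq> word_module S"
    using keys_extend_nths[where c = "\<lambda>_ _. 1"] by (auto simp: subword_map_def)
  show "subword_map_inverse ` word_module S \<subseteq> word_module S"
    using keys_extend_nths by (auto simp: subword_map_inverse_def)
qed (auto simp: subword_map_inverse_left subword_map_inverse_right)

lemma inv_into_subword_map:
  assumes "x \<in> word_module S"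
  shows "inv_into (word_module S) subword_map x = subword_map_inverse x"
proof -
  have "subword_map_inverse x \<in> word_module S"
    using keys_extend_nths[OF assms] by (auto simp: subword_map_inverse_def)
  then show ?thesis
    using bij_betw_subword_map[of S]
    by (metis bij_betw_def inv_into_f_f subword_map_inverse_right)
qed

end

(* Identifying each crossing with its opposite turns Artin's presentation into the Coxeter
   presentation of the symmetric group, so a pure braid becomes trivial after finitely many crossing
   changes. Hence, if F vanishes on diagrams with more than n double points and u is a pure braid,
   then v \<mapsto> F (u v) - F v vanishes on diagrams with more than n - 1 double points, because the two
   terms are connected by crossing changes in u and each such change creates one more double point.
   The value of \<omega> on g_1 ... g_m is the m-fold iteration of this difference. *)

theory Submission
  imports Defs
begin

section \<open>The Coxeter presentation of the symmetric group\<close>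

text \<open>The involution relations are written as generator = inverse rather than as trivial
  squares, so that applying one of them is exactly one crossing change.\<close>

definition coxeter_relations :: "nat \<Rightarrow> (nat signed_word \<times> nat signed_word) set" where
  "coxeter_relations k =
     artin_relations k \<union> {([(i, True)], [(i, False)]) | i. i \<in> {1..<k}}"

abbreviation coxeter_eq :: "nat \<Rightarrow> nat signed_word \<Rightarrow> nat signed_word \<Rightarrow> bool" where
  "coxeter_eq k \<equiv> pres_eq {1..<k} (coxeter_relations k)"

abbreviation positive_word :: "nat list \<Rightarrow> nat signed_word" where
  "positive_word \<equiv> map (\<lambda>i. (i, True))"

lemma pres_eq_mono:
  assumes "pres_eq X R u v" "X \<subseteq> Y" "R \<subseteq> Q"
  shows "pres_eq Y Q u v"
  using assms by (induction rule: pres_eq.induct) (blast intro: pres_eq.intros)+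

text \<open>A context added by \<open>pres_congr\<close> is common to both sides, and relations and
  cancelling pairs only use letters over \<open>X\<close>. This carries well-formedness along
  derivations in \<open>crossing_change_invariant\<close>.\<close>

lemma pres_eq_signed_words:
  assumes "pres_eq X R u v" "R \<subseteq> signed_words X \<times> signed_words X"
  shows "u \<in> signed_words X \<longleftrightarrow> v \<in> signed_words X"
  using assms by (induction rule: pres_eq.induct) (auto simp: signed_words_def)

lemma coxeter_relations_signed_words:
  "coxeter_relations k \<subseteq> signed_words {1..<k} \<times> signed_words {1..<k}"
  by (auto simp: coxeter_relations_def artin_relations_def signed_words_def)

lemma coxeter_eq_Suc: "coxeter_eq k u v \<Longrightarrow> coxeter_eq (Suc k) u v"
  by (rule pres_eq_mono) (auto simp: coxeter_relations_def artin_relations_def)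

text \<open>\<open>strand_perm\<close> reads only positions and is blind to signs, so the additional
  relations do not affect it.\<close>

lemma strand_perm_coxeter:
  "coxeter_eq k u v \<Longrightarrow> strand_perm (map fst u) = strand_perm (map fst v)"
proof (induction rule: pres_eq.induct)
  case (pres_congr u v p q)
  then show ?case by (simp add: strand_perm_append)
next
  case (pres_cancel x b)
  show ?case by (auto simp: strand_perm_def)
next
  case (pres_relation u v)
  then show ?case
    unfolding coxeter_relations_def
    by (auto dest: pres_eq.pres_relation[THEN strand_perm_artin])
qed auto

lemma coxeter_positive:
  assumes "i \<in> {1..<k}"
  shows "coxeter_eq k [(i, b)] (positive_word [i])"
  using assms
  by (cases b) (auto simp: coxeter_relations_def intro: pres_refl pres_sym[OF pres_relation])

lemma coxeter_involution:
  assumes "i \<in> {1..<k}"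
  shows "coxeter_eq k (positive_word [i, i]) []"
proof -
  have "coxeter_eq k ([(i, True)] @ [(i, True)]) ([(i, True)] @ [(i, False)])"
    using pres_sym[OF coxeter_positive[OF assms, of False]]
    by (intro pres_eq_append pres_refl) simp
  with pres_cancel[OF assms, of "coxeter_relations k" True] show ?thesis
    by (auto intro: pres_trans)
qed

lemma coxeter_commute_letter:
  assumes "i \<in> {1..<k}" "j \<in> {1..<k}" "i + 2 \<le> j \<or> j + 2 \<le> i"
  shows "coxeter_eq k (positive_word [i, j]) (positive_word [j, i])"
  using assms(3)
proof
  assume "i + 2 \<le> j"
  with assms(1,2) show ?thesis
    by (intro pres_relation) (auto simp: coxeter_relations_def artin_relations_def)
next
  assume "j + 2 \<le> i"
  with assms(1,2) show ?thesis
    by (intro pres_sym[OF pres_relation]) (auto simp: coxeter_relations_def artin_relations_def)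
qed

lemma coxeter_commute:
  assumes "i \<in> {1..<k}" "\<And>j. j \<in> set w \<Longrightarrow> j \<in> {1..<k} \<and> (i + 2 \<le> j \<or> j + 2 \<le> i)"
  shows "coxeter_eq k (positive_word (w @ [i])) (positive_word (i # w))"
  using assms(2)
proof (induction w)
  case Nil
  show ?case by (simp add: pres_refl)
next
  case (Cons j w)
  then have "coxeter_eq k (positive_word (w @ [i])) (positive_word (i # w))" by simp
  from pres_congr[OF this, of "positive_word [j]" "[]"]
  have "coxeter_eq k (positive_word ((j # w) @ [i])) (positive_word (j # i # w))" by simp
  moreover have "coxeter_eq k (positive_word (j # i # w)) (positive_word (i # j # w))"
    using Cons.prems[of j] assms(1)
      pres_congr[OF coxeter_commute_letter[of j k i], of "[]" "positive_word w"] by auto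
  ultimately show ?case by (rule pres_trans)
qed

section \<open>Descending words as coset representatives in the symmetric group\<close>

lemma rev_upt_split: "j \<le> i \<Longrightarrow> i \<le> m \<Longrightarrow> rev [j..<m] = rev [i..<m] @ rev [j..<i]"
  using upt_add_eq_append[of j i "m - i"] by (simp flip: rev_append)

text \<open>Coming from the right, \<open>i\<close> commutes past the letters below
  \<open>i - 1\<close> and meets \<open>i, i - 1\<close>. The braid relation turns
  \<open>i, i - 1, i\<close> into \<open>i - 1, i, i - 1\<close>, whose first letter commutes past
  the letters above \<open>i\<close>.\<close>

lemma coxeter_descending_shift:
  assumes "1 \<le> j" "j < i" "i < k"
  shows "coxeter_eq k (positive_word (rev [j..<k] @ [i])) (positive_word ((i - 1) # rev [j..<k]))"
proof -
  obtain h where h: "i = Suc h" using assms by (cases i) auto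
  define a where "a = rev [Suc i..<k]"
  define c where "c = rev [j..<h]"
  have split: "rev [j..<k] = a @ [i, h] @ c"
    using assms rev_upt_split[of j "Suc i" k] by (simp add: a_def c_def h)
  have "coxeter_eq k (positive_word (c @ [i])) (positive_word (i # c))"
    by (rule coxeter_commute) (use assms h in \<open>auto simp: c_def\<close>)
  from pres_congr[OF this, of "positive_word (a @ [i, h])" "[]"]
  have 1: "coxeter_eq k (positive_word (rev [j..<k] @ [i])) (positive_word (a @ [i, h, i] @ c))"
    by (simp add: split)
  have "coxeter_eq k (positive_word [i, h, i]) (positive_word [h, i, h])"
    by (rule pres_sym[OF pres_relation])
      (use assms h in \<open>auto simp: coxeter_relations_def artin_relations_def\<close>)
  from pres_congr[OF this, of "positive_word a" "positive_word c"]
  have 2: "coxeter_eq k (positive_word (a @ [i, h, i] @ c)) (positive_word (a @ [h, i, h] @ c))"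
    by simp
  have "coxeter_eq k (positive_word (a @ [h])) (positive_word (h # a))"
    by (rule coxeter_commute) (use assms h in \<open>auto simp: a_def\<close>)
  from pres_congr[OF this, of "[]" "positive_word ([i, h] @ c)"]
  have 3: "coxeter_eq k (positive_word (a @ [h, i, h] @ c)) (positive_word (h # rev [j..<k]))"
    by (simp add: split)
  show ?thesis using pres_trans[OF pres_trans[OF 1 2] 3] by (simp add: h)
qed

text \<open>The descending words from \<open>k\<close> down to \<open>j\<close> represent the cosets
  of the symmetric group on \<open>k\<close> letters in the one on \<open>k + 1\<close> letters;
  \<open>j = Suc k\<close> gives the empty word. It suffices that these products are stable under
  right multiplication by a generator.\<close>

lemma coxeter_normal_form:
  assumes "u \<in> signed_words {1..<Suc k}"
  shows "\<exists>v j. v \<in> signed_words {1..<k} \<and> 1 \<le> j \<and> j \<le> Suc k \<and>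
    coxeter_eq (Suc k) u (v @ positive_word (rev [j..<Suc k]))"
  using assms
proof (induction u rule: rev_induct)
  case Nil
  show ?case
    by (rule exI[of _ "[]"], rule exI[of _ "Suc k"]) (simp add: pres_refl)
next
  case (snoc a u)
  let ?N = "\<lambda>j. positive_word (rev [j..<Suc k])"
  obtain i b where a: "a = (i, b)" by fastforce
  with snoc.prems have u: "u \<in> signed_words {1..<Suc k}" and i: "1 \<le> i" "i < Suc k"
    by (auto simp: signed_words_def)
  from snoc.IH[OF u] obtain v j where v: "v \<in> signed_words {1..<k}" and j: "1 \<le> j" "j \<le> Suc k"
    and eq: "coxeter_eq (Suc k) u (v @ ?N j)" by blast
  have eq: "coxeter_eq (Suc k) (u @ [a]) (v @ ?N j @ positive_word [i])"
    using pres_eq_append[OF eq coxeter_positive[of i "Suc k" b]] i by (simp add: a)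
  \<comment> \<open>The new letter respectively commutes into \<open>v\<close>, lengthens the
    descending word, cancels its last letter, or passes through it into \<open>v\<close> as
    \<open>i - 1\<close>.\<close>
  consider "Suc i < j" | "Suc i = j" | "i = j" | "j < i" by linarith
  then show ?case
  proof cases
    case 1
    have "coxeter_eq (Suc k) (positive_word (rev [j..<Suc k] @ [i]))
        (positive_word (i # rev [j..<Suc k]))"
      by (rule coxeter_commute) (use 1 i j in auto)
    from pres_congr[OF this, of v "[]"]
    have "coxeter_eq (Suc k) (v @ ?N j @ positive_word [i]) ((v @ positive_word [i]) @ ?N j)"
      by simp
    moreover have "v @ positive_word [i] \<in> signed_words {1..<k}"
      using v 1 i j by (auto simp: signed_words_def)
    ultimately show ?thesis using eq j by (meson pres_trans)
  next
    case 2
    have "rev [i..<Suc k] = rev [j..<Suc k] @ [i]"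
      using rev_upt_split[of i j "Suc k"] 2 i by auto
    then have "?N i = ?N j @ positive_word [i]" by (simp del: upt_Suc)
    with eq v i show ?thesis by (metis less_imp_le)
  next
    case 3
    have "rev [j..<Suc k] = rev [Suc j..<Suc k] @ [i]"
      using rev_upt_split[of j "Suc j" "Suc k"] 3 i by auto
    then have "v @ ?N j @ positive_word [i] = (v @ ?N (Suc j)) @ positive_word [i, i] @ []"
      by (simp del: upt_Suc)
    with eq have "coxeter_eq (Suc k) (u @ [a]) ((v @ ?N (Suc j)) @ positive_word [i, i] @ [])"
      by (simp only:)
    moreover have "coxeter_eq (Suc k) ((v @ ?N (Suc j)) @ positive_word [i, i] @ [])
        ((v @ ?N (Suc j)) @ [] @ [])"
      using i by (intro pres_congr coxeter_involution) auto
    ultimately have "coxeter_eq (Suc k) (u @ [a]) ((v @ ?N (Suc j)) @ [] @ [])"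
      by (rule pres_trans)
    then have "coxeter_eq (Suc k) (u @ [a]) (v @ ?N (Suc j))" by (simp del: upt_Suc)
    moreover have "1 \<le> Suc j" "Suc j \<le> Suc k" using 3 i by auto
    ultimately show ?thesis using v by blast
  next
    case 4
    from pres_congr[OF coxeter_descending_shift[OF j(1) 4 i(2)], of v "[]"]
    have "coxeter_eq (Suc k) (v @ ?N j @ positive_word [i])
        ((v @ positive_word [i - 1]) @ ?N j)"
      by (simp del: upt_Suc)
    moreover have "v @ positive_word [i - 1] \<in> signed_words {1..<k}"
      using v 4 i j by (auto simp: signed_words_def)
    ultimately show ?thesis using eq j by (meson pres_trans)
  qed
qed

lemma strand_perm_fixes:
  assumes "\<And>i. i \<in> set w \<Longrightarrow> Suc i < m"
  shows "strand_perm w m = m"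
  using assms by (induction w) (fastforce simp: strand_perm_def transpose_def)+

text \<open>The rightmost transposition acts first, so the point \<open>j\<close> is moved up by one
  at each letter.\<close>

lemma strand_perm_descending: "j \<le> m \<Longrightarrow> strand_perm (rev [j..<m]) j = m"
proof (induction m)
  case (Suc m)
  then show ?case
    by (cases "j = Suc m") (auto simp: strand_perm_def)
qed (simp add: strand_perm_def)

text \<open>Faithfulness of the Coxeter presentation, by induction on the number of strands: purity
  forces the descending factor of the normal form to be empty, which leaves a pure word on one
  strand fewer.\<close>

lemma coxeter_trivial_if_pure:
  assumes "u \<in> signed_words {1..<k}" "strand_perm (map fst u) = id"
  shows "coxeter_eq k u []"
  using assms
proof (induction k arbitrary: u)
  case 0
  then show ?case by (simp add: signed_words_def pres_refl)
next
  case (Suc k)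
  from coxeter_normal_form[OF Suc.prems(1)] obtain v j where v: "v \<in> signed_words {1..<k}"
    and j: "1 \<le> j" "j \<le> Suc k"
    and eq: "coxeter_eq (Suc k) u (v @ positive_word (rev [j..<Suc k]))" by blast
  have "map fst (v @ positive_word w) = map fst v @ w" for w
    by (simp add: comp_def)
  with strand_perm_coxeter[OF eq] Suc.prems(2)
  have sp: "strand_perm (map fst v) \<circ> strand_perm (rev [j..<Suc k]) = id"
    by (simp only: strand_perm_append)
  have "strand_perm (map fst v) (Suc k) = Suc k"
    using v by (intro strand_perm_fixes) (auto simp: signed_words_def)
  \<comment> \<open>The descending word sends \<open>j\<close> to \<open>Suc k\<close>, which
    \<open>v\<close> fixes, while the whole product is the identity.\<close>
  with fun_cong[OF sp, of j] j have "j = Suc k"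
    by (simp add: strand_perm_descending del: upt_Suc)
  with sp eq have "strand_perm (map fst v) = id" and eq': "coxeter_eq (Suc k) u v"
    by (simp_all add: strand_perm_def)
  with Suc.IH[OF v] show ?case
    by (blast intro: coxeter_eq_Suc pres_trans)
qed


section \<open>Crossing changes\<close>

text \<open>A Coxeter derivation consists of braid moves and crossing changes. Since
  \<open>change\<close> is available for pure words only, the symmetric and transitive cases
  transport well-formedness and purity along the derivation.\<close>

lemma crossing_change_invariant:
  assumes braid: "\<And>u v. pres_eq {1..<k} (artin_relations k) u v \<Longrightarrow> H u = H v"
    and change: "\<And>p i q. p @ (i, True) # q \<in> signed_words {1..<k} \<Longrightarrow>
      strand_perm (map fst (p @ (i, True) # q)) = id \<Longrightarrow>
      H (p @ (i, True) # q) = H (p @ (i, False) # q)"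
    and "coxeter_eq k u v" "u \<in> signed_words {1..<k}" "strand_perm (map fst u) = id"
  shows "H u = H v"
proof -
  \<comment> \<open>The context is quantified so that \<open>pres_congr\<close> is absorbed into it;
    only the complete word has to be pure, not the part being rewritten.\<close>
  have "H (p @ u @ q) = H (p @ v @ q)"
    if "p @ u @ q \<in> signed_words {1..<k}" "strand_perm (map fst (p @ u @ q)) = id" for p q
    using \<open>coxeter_eq k u v\<close> that
  proof (induction arbitrary: p q rule: pres_eq.induct)
    case (pres_sym u v)
    from pres_sym.hyps have "coxeter_eq k (p @ u @ q) (p @ v @ q)" by (rule pres_congr)
    with pres_sym show ?case
      by (metis pres_eq_signed_words[OF _ coxeter_relations_signed_words] strand_perm_coxeter)
  next
    case (pres_trans u v w)
    from pres_trans.hyps(1) have "coxeter_eq k (p @ u @ q) (p @ v @ q)" by (rule pres_congr)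
    with pres_trans show ?case
      by (metis pres_eq_signed_words[OF _ coxeter_relations_signed_words] strand_perm_coxeter)
  next
    case (pres_congr u v p' q')
    from pres_congr.IH[of "p @ p'" "q' @ q"] pres_congr.prems show ?case by simp
  next
    case (pres_cancel x b)
    then show ?case by (intro braid pres_congr pres_eq.pres_cancel)
  next
    case (pres_relation u v)
    then consider "(u, v) \<in> artin_relations k" | i where "u = [(i, True)]" "v = [(i, False)]"
      unfolding coxeter_relations_def by blast
    then show ?case
    proof cases
      case 1
      then show ?thesis by (intro braid pres_congr pres_eq.pres_relation)
    next
      case 2
      with change[of p i q] pres_relation.prems show ?thesis by (simp only: append_Cons append_Nil)
    qed
  qed simp
  from this[of "[]" "[]"] assms(4,5) show ?thesis by simp
qed

section \<open>Resolution of singular diagrams\<close>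

abbreviation crossings :: "nat signed_word \<Rightarrow> singular_letter list" where
  "crossings \<equiv> map (\<lambda>(i, b). Crossing i b)"

lemma resolve_crossings: "resolve f (crossings u @ d) = resolve (\<lambda>v. f (u @ v)) d"
  by (induction u arbitrary: f) auto

lemma resolve_diff: "resolve (\<lambda>u. f u - g u) d = resolve f d - resolve g d"
  by (induction d arbitrary: f g rule: resolve.induct) (simp_all add: algebra_simps)

lemma position_crossings: "map position (crossings u) = map fst u"
  by (induction u) auto

lemma double_points_crossings [simp]: "double_points (crossings u) = 0"
  by (auto simp: double_points_def filter_empty_conv)

lemma double_points_append [simp]: "double_points (c @ d) = double_points c + double_points d"
  by (simp add: double_points_def)

lemma crossings_singular_pure_braids:
  assumes "u \<in> signed_words {1..<k}" "strand_perm (map fst u) = id"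
  shows "crossings u \<in> singular_pure_braids k"
  using assms unfolding singular_pure_braids_def position_crossings mem_Collect_eq
  by (auto simp: signed_words_def)

text \<open>A pure \<open>u\<close> can be unwound to the empty word by braid moves and crossing
  changes. Each change alters the value by the resolution of a diagram with one double point more
  than \<open>d\<close>, which vanishes.\<close>

lemma resolve_pure_factor:
  assumes braid: "\<And>u v. pres_eq {1..<k} (artin_relations k) u v \<Longrightarrow> F u = F v"
    and vanish: "\<And>d. d \<in> singular_pure_braids k \<Longrightarrow> Suc n \<le> double_points d \<Longrightarrow> resolve F d = 0"
    and u: "u \<in> signed_words {1..<k}" "strand_perm (map fst u) = id"
    and d: "d \<in> singular_pure_braids k" "n \<le> double_points d"
  shows "resolve (\<lambda>v. F (u @ v)) d = resolve F d"
proof -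
  define H where "H u = resolve (\<lambda>v. F (u @ v)) d" for u
  have "H u = H []"
  proof (rule crossing_change_invariant)
    show "coxeter_eq k u []" using u by (rule coxeter_trivial_if_pure)
    show "H u = H v" if "pres_eq {1..<k} (artin_relations k) u v" for u v
    proof -
      have "(\<lambda>w. F (u @ w)) = (\<lambda>w. F (v @ w))"
        using that by (auto intro!: braid pres_eq_append pres_refl)
      then show ?thesis by (simp add: H_def)
    qed
    fix p i q
    assume w: "p @ (i, True) # q \<in> signed_words {1..<k}"
      and sp: "strand_perm (map fst (p @ (i, True) # q)) = id"
    \<comment> \<open>The changed crossing becomes a double point. The positions stay the same, so
      the diagram is still pure, and resolving the new point gives the difference of the two values
      of \<open>H\<close>.\<close>
    let ?d = "crossings p @ DoublePoint i # crossings q @ d"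
    have "map position ?d = map fst (p @ (i, True) # q) @ map position d"
      by (simp add: position_crossings[simplified])
    with sp d(1) have "strand_perm (map position ?d) = id"
      by (simp only: strand_perm_append singular_pure_braids_def mem_Collect_eq id_comp)
    with w d(1) have "?d \<in> singular_pure_braids k"
      by (auto simp: singular_pure_braids_def signed_words_def)
    moreover have "Suc n \<le> double_points ?d"
      using d(2) double_points_append[of "[DoublePoint i]" "crossings q @ d"]
      by (simp add: double_points_def)
    ultimately have "resolve F ?d = 0" by (rule vanish)
    moreover have "resolve F ?d = H (p @ (i, True) # q) - H (p @ (i, False) # q)"
      by (simp add: resolve_crossings H_def)
    ultimately show "H (p @ (i, True) # q) = H (p @ (i, False) # q)" by simp
  qed (use u in auto)
  then show ?thesis by (simp add: H_def)
qed


section \<open>Iterated differences\<close>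

text \<open>The alternating sum of \<open>f\<close> over all subwords, organised as the product of
  the factors \<open>x - 1\<close> from left to right.\<close>

fun iterated_difference :: "('s list \<Rightarrow> 'a::ab_group_add) \<Rightarrow> 's list \<Rightarrow> 'a" where
  "iterated_difference f [] = f []"
| "iterated_difference f (x # w) =
     iterated_difference (\<lambda>v. f (x # v)) w - iterated_difference f w"

lemma iterated_difference_diff:
  "iterated_difference (\<lambda>v. f v - g v) w = iterated_difference f w - iterated_difference g w"
  by (induction w arbitrary: f g) (simp_all add: algebra_simps)

text \<open>Splitting off \<open>u\<close> replaces \<open>F\<close> by the difference of
  \<open>F (u @ v)\<close> and \<open>F v\<close>, which by \<open>resolve_pure_factor\<close>
  lowers the threshold for vanishing by one. When the list is exhausted the threshold is 0, so the
  value on the empty diagram vanishes.\<close>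

lemma iterated_difference_vanishes:
  assumes "\<And>u v. pres_eq {1..<k} (artin_relations k) u v \<Longrightarrow> F u = F v"
    and "\<And>d. d \<in> singular_pure_braids k \<Longrightarrow> n \<le> double_points d \<Longrightarrow> resolve F d = 0"
    and "\<And>u. u \<in> set us \<Longrightarrow> u \<in> signed_words {1..<k} \<and> strand_perm (map fst u) = id"
    and "n \<le> length us"
  shows "iterated_difference (\<lambda>vs. F (concat vs)) us = 0"
  using assms
proof (induction us arbitrary: F n)
  case Nil
  then have "resolve F (crossings []) = 0"
    by (intro Nil.prems(2) crossings_singular_pure_braids) (auto simp: strand_perm_def)
  then show ?case by simp
next
  case (Cons u us)
  let ?G = "\<lambda>v. F (u @ v) - F v"
  have u: "u \<in> signed_words {1..<k}" "strand_perm (map fst u) = id"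
    using Cons.prems(3)[of u] by auto
  \<comment> \<open>For \<open>n = 0\<close> the bound \<open>Suc (n - 1)\<close> is 1, which is
    stronger than \<open>n\<close>, so truncated subtraction does no harm.\<close>
  have vanish: "resolve F d = 0" if "d \<in> singular_pure_braids k" "Suc (n - 1) \<le> double_points d" for d
    using that by (intro Cons.prems(2)) auto
  have "iterated_difference (\<lambda>vs. ?G (concat vs)) us = 0"
  proof (rule Cons.IH[where n = "n - 1"])
    show "?G v = ?G w" if "pres_eq {1..<k} (artin_relations k) v w" for v w
      using that by (metis Cons.prems(1) pres_eq_append pres_refl)
    show "resolve ?G d = 0" if "d \<in> singular_pure_braids k" "n - 1 \<le> double_points d" for d
      using resolve_pure_factor[where F = F and k = k and n = "n - 1", OF Cons.prems(1) vanish u that]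
      by (simp add: resolve_diff)
  qed (use Cons.prems in auto)
  then show ?case by (simp add: iterated_difference_diff)
qed

lemma iterated_difference_map:
  "iterated_difference f (map h w) = iterated_difference (\<lambda>v. f (map h v)) w"
  by (induction w arbitrary: f) simp_all

text \<open>Only subwords of \<open>w\<close> are evaluated, and these are again words over
  \<open>S\<close>.\<close>

lemma iterated_difference_cong_lists:
  assumes "w \<in> lists S" "\<And>v. v \<in> lists S \<Longrightarrow> f v = g v"
  shows "iterated_difference f w = iterated_difference g w"
  using assms
proof (induction w arbitrary: f g rule: list.induct)
  case (Cons x w)
  then have "x \<in> S" "w \<in> lists S" by auto
  moreover have "f (x # v) = g (x # v)" if "v \<in> lists S" for v
    using that \<open>x \<in> S\<close> by (intro Cons.prems(2)) auto
  ultimately show ?case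
    using Cons.IH[of "\<lambda>v. f (x # v)" "\<lambda>v. g (x # v)"] Cons.IH[of f g] Cons.prems(2) by simp
qed simp

section \<open>Integer multiples and linear extension to formal combinations\<close>

lemma sum_const_lessThan_add:
  fixes a :: "'a::ab_group_add"
  shows "(\<Sum>_<m + n. a) = (\<Sum>_<m. a) + (\<Sum>_<n::nat. a)"
  by (induction n) (simp_all add: add.assoc)

text \<open>Allows any representation of an integer as a difference of naturals, so that additivity
  in the integer follows without a case distinction on signs.\<close>

lemma int_multiple_of_nat_diff:
  fixes a :: "'a::ab_group_add"
  shows "int_multiple (int m - int n) a = (\<Sum>_<m. a) - (\<Sum>_<n. a)"
proof (cases "n \<le> m")
  case True
  then show ?thesis
    using sum_const_lessThan_add[of a "m - n" n] by (simp add: int_multiple_def nat_diff_distrib)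
next
  case False
  then show ?thesis
    using sum_const_lessThan_add[of a "n - m" m] by (simp add: int_multiple_def nat_diff_distrib)
qed

lemma int_multiple_diff: "int_multiple (x - y) a = int_multiple x a - int_multiple y a"
proof -
  obtain m n where x: "x = int m - int n" by (rule int_diff_cases)
  obtain p q where y: "y = int p - int q" by (rule int_diff_cases)
  have "x - y = int (m + q) - int (n + p)" by (simp add: x y)
  then show ?thesis
    unfolding x y by (simp only: int_multiple_of_nat_diff sum_const_lessThan_add) simp
qed

lemma int_multiple_simps [simp]: "int_multiple 0 a = 0" "int_multiple 1 a = a"
  by (simp_all add: int_multiple_def)

text \<open>Coefficients outside the support are zero. A common index set is needed because
  cancellation can shrink the support of a difference.\<close>

lemma linear_extension_superset:
  assumes "finite B" "Poly_Mapping.keys x \<subseteq> B"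
  shows "linear_extension f x = (\<Sum>b\<in>B. int_multiple (Poly_Mapping.lookup x b) (f b))"
  unfolding linear_extension_def
  using assms by (intro sum.mono_neutral_left) (auto simp: in_keys_iff)

lemma linear_extension_diff:
  "linear_extension f (x - y) = linear_extension f x - linear_extension f y"
proof -
  let ?B = "Poly_Mapping.keys x \<union> Poly_Mapping.keys y"
  have "Poly_Mapping.keys (x - y) \<subseteq> ?B" by (rule keys_diff)
  then show ?thesis
    by (simp add: linear_extension_superset[of ?B] lookup_minus int_multiple_diff sum_subtractf)
qed

lemma linear_extension_of [simp]: "linear_extension f (frag_of w) = f w"
  by (simp add: linear_extension_def)

lemma linear_extension_zero [simp]: "linear_extension f 0 = 0"
  by (simp add: linear_extension_def)

lemma linear_extension_prefix_letter:
  "linear_extension f (prefix_letter x y) = linear_extension (\<lambda>w. f (x # w)) y"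
  by (induction y rule: frag_induct)
    (simp_all add: prefix_letter_def frag_extend_diff linear_extension_diff)

text \<open>Both sides obey the same recursion: a leading letter \<open>x\<close> contributes the
  factor \<open>x - 1\<close>.\<close>

lemma linear_extension_subword_map_inverse:
  "linear_extension f (subword_map_inverse (frag_of w)) = iterated_difference f w"
proof (induction w arbitrary: f)
  case Nil
  show ?case by (simp add: subword_map_inverse_def)
next
  case (Cons x w)
  then show ?case
    by (simp add: frag_of_Cons subword_map_inverse_prefix linear_extension_diff
        linear_extension_prefix_letter)
qed

section \<open>From words in pure braids to braid diagrams\<close>

lemma pure_braid_representative:
  assumes "g \<in> carrier (pure_braid_group k)"
  obtains u where "u \<in> signed_words {1..<k}" "strand_perm (map fst u) = id" "g = braid_of k u"
proof -
  from assms obtain u where u: "u \<in> signed_words {1..<k}" "g = braid_of k u"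
    by (auto simp: pure_braid_group_def braid_group_def presented_group_def braid_of_def)
  \<comment> \<open>Purity is imposed on every member of the class, hence in particular on
    \<open>u\<close>.\<close>
  then have "u \<in> g" by (simp add: braid_of_def pres_class_def pres_refl)
  with assms u that show thesis by (auto simp: pure_braid_group_def)
qed

lemma eval_word_braid_of:
  assumes "us \<in> lists (signed_words {1..<k})"
  shows "eval_word (pure_braid_group k) (map (braid_of k) us) = braid_of k (concat us)"
  using assms
proof (induction us rule: list.induct)
  case Nil
  show ?case
    by (simp add: eval_word_def pure_braid_group_def braid_group_def presented_group_def
        braid_of_def)
next
  case (Cons u us)
  then have "concat us \<in> signed_words {1..<k}" by (fastforce simp: signed_words_def in_lists_conv_set)
  with Cons show ?case
    by (simp add: eval_word_def pure_braid_group_def braid_group_def braid_of_def mult_pres_class)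
qed

text \<open>Each letter is a pure braid and is lifted to a diagram word. Evaluation then becomes
  concatenation, and the alternating sum becomes the iterated difference treated above.\<close>

lemma type_invariant_alternating_sum:
  assumes "type_invariant k n \<nu>" "w \<in> lists (carrier (pure_braid_group k))" "n < length w"
  shows "invariant_on_words (pure_braid_group k) \<nu> (subword_map_inverse (frag_of w)) = 0"
proof -
  let ?P = "{u \<in> signed_words {1..<k}. strand_perm (map fst u) = id}"
  have "w \<in> map (braid_of k) ` lists ?P"
    using assms(2) unfolding lists_image[symmetric]
    by (auto simp: in_lists_conv_set elim!: pure_braid_representative)
  then obtain us where us: "us \<in> lists ?P" and w: "w = map (braid_of k) us" by blast
  have "iterated_difference (\<lambda>vs. \<nu> (braid_of k (concat vs))) us = 0"
  \<comment> \<open>Type \<open>n\<close> means vanishing on more than \<open>n\<close> double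
    points, so the inclusive threshold is \<open>Suc n\<close>.\<close>
  proof (rule iterated_difference_vanishes[where n = "Suc n" and F = "\<lambda>u. \<nu> (braid_of k u)"])
    show "\<nu> (braid_of k u) = \<nu> (braid_of k v)"
      if "pres_eq {1..<k} (artin_relations k) u v" for u v
      by (simp only: braid_of_def pres_class_eqI[OF that])
    show "resolve (\<lambda>u. \<nu> (braid_of k u)) d = 0"
      if "d \<in> singular_pure_braids k" "Suc n \<le> double_points d" for d
      using assms(1) that by (auto simp: type_invariant_def singular_extension_def)
  qed (use us assms(3) w in auto)
  moreover have "iterated_difference (\<lambda>vs. \<nu> (eval_word (pure_braid_group k) (map (braid_of k) vs))) us
      = iterated_difference (\<lambda>vs. \<nu> (braid_of k (concat vs))) us"
    by (rule iterated_difference_cong_lists[OF us]) (subst eval_word_braid_of; auto)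
  ultimately show ?thesis
    by (simp add: invariant_on_words_def linear_extension_subword_map_inverse w
        iterated_difference_map)
qed

theorem mainTheorem5:
  fixes k n :: nat
    and X :: "braid set"
    and R :: "(braid signed_word \<times> braid signed_word) set"
    and \<nu> :: "braid \<Rightarrow> 'a::ab_group_add"
  assumes "k \<ge> 1"
    and "finite_presentation (pure_braid_group k) X R"
    and "type_invariant k n \<nu>"
  shows "let S = letters (pure_braid_group k) X;
             \<nu>' = invariant_on_words (pure_braid_group k) \<nu>;
             \<omega> = \<nu>' \<circ> inv_into (word_module S) subword_map
         in (\<forall>x\<in>word_module S. \<nu>' x = (\<omega> \<circ> subword_map) x) \<and>
            (\<forall>w\<in>lists S. length w > n \<longrightarrow> \<omega> (frag_of w) = 0)"
proof -
  interpret group "pure_braid_group k" by (rule group_pure_braid_group)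
  let ?S = "letters (pure_braid_group k) X"
  have S: "?S \<subseteq> carrier (pure_braid_group k)"
    using assms(2) by (auto simp: letters_def finite_presentation_def)
  have "inv_into (word_module ?S) subword_map (subword_map x) = x" if "x \<in> word_module ?S" for x
    using bij_betw_subword_map[of ?S] that by (simp add: bij_betw_def)
  moreover have "invariant_on_words (pure_braid_group k) \<nu>
      (inv_into (word_module ?S) subword_map (frag_of w)) = 0"
    if "w \<in> lists ?S" "n < length w" for w
  proof -
    \<comment> \<open>On \<open>word_module\<close> the abstract \<open>inv_into\<close> agrees with
      the explicit alternating formula.\<close>
    have "frag_of w \<in> word_module ?S"
      using that(1) by (simp add: word_module_def carrier_free_Abelian_group_iff)
    moreover have "w \<in> lists (carrier (pure_braid_group k))"
      using that(1) S by auto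
    ultimately show ?thesis
      using type_invariant_alternating_sum[OF assms(3) _ that(2)] by (simp add: inv_into_subword_map)
  qed
  ultimately show ?thesis by (simp add: Let_def)
qed

end
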